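(* If $G$ is the incidence graph of a transversal design $TD(k,n)$ with $k \ge 4$, then $\zeta(G) \le n + k - 4$.
   Context: A transversal design $TD(k,n)$ is a pair $(X,\mathcal{B})$ where $X$ is a set of $kn$ points partitioned into $k$ groups $G_1,\dots,G_k$ each of size $n$, and $\mathcal{B}$ is a collection of blocks of size $k$, each containing exactly one point of each group, such that every two points from different groups lie in exactly one block. Its incidence graph is the bipartite graph on $X \cup \mathcal{B}$ with $x \sim B$ iff $x \in B$. Localization game on a connected graph $G$ with $m$ cops: the robber chooses a starting vertex, invisible to the cops. Each round the cops choose any $m$ vertices (no adjacency restriction) and each learns its distance to the robber; the cops win if after finitely many rounds they determine the robber's vertex uniquely; otherwise the robber moves to a neighbour or stays. The robber knows the cops' strategy. $\zeta(G)$ is the least $m$ for which $m$ cops can guarantee capture. *)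

theory Defs
  imports Main "HOL-Library.Disjoint_Sets"
begin

text \<open>
  Since \<^const>\<open>partition_on\<close> has no empty parts, \<open>k \<ge> 1\<close> forces \<open>n \<ge> 1\<close>. For \<open>k \<ge> 2\<close> no block can
  be repeated, so a set of blocks loses nothing against a multiset.
\<close>

definition transversal_design ::
  "nat \<Rightarrow> nat \<Rightarrow> 'a set \<Rightarrow> 'a set set \<Rightarrow> 'a set set \<Rightarrow> bool" where
  "transversal_design k n X \<G> \<B> \<longleftrightarrow>
     finite X \<and> card X = k * n \<and>
     partition_on X \<G> \<and> card \<G> = k \<and> (\<forall>G\<in>\<G>. card G = n) \<and>
     (\<forall>B\<in>\<B>. B \<subseteq> X \<and> card B = k \<and> (\<forall>G\<in>\<G>. card (B \<inter> G) = 1)) \<and>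
     (\<forall>G\<in>\<G>. \<forall>H\<in>\<G>. G \<noteq> H \<longrightarrow> (\<forall>x\<in>G. \<forall>y\<in>H. \<exists>!B. B \<in> \<B> \<and> x \<in> B \<and> y \<in> B))"

text \<open>
  A graph is given by its vertex set \<open>V\<close> and a symmetric irreflexive edge relation \<open>E \<subseteq> V \<times> V\<close>.
\<close>

definition incidence_verts :: "'a set \<Rightarrow> 'a set set \<Rightarrow> ('a + 'a set) set" where
  "incidence_verts X \<B> = X <+> \<B>"

definition incidence_edges :: "'a set \<Rightarrow> 'a set set \<Rightarrow> (('a + 'a set) \<times> ('a + 'a set)) set" where
  "incidence_edges X \<B> =
     {(Inl x, Inr B) | x B. x \<in> X \<and> B \<in> \<B> \<and> x \<in> B} \<union>
     {(Inr B, Inl x) | x B. x \<in> X \<and> B \<in> \<B> \<and> x \<in> B}"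

text \<open>The length of a shortest walk; unspecified if there is no walk from \<open>u\<close> to \<open>v\<close>.\<close>

definition graph_dist :: "('v \<times> 'v) set \<Rightarrow> 'v \<Rightarrow> 'v \<Rightarrow> nat" where
  "graph_dist E u v = (LEAST d. (u, v) \<in> E ^^ d)"

definition robber_walk :: "'v set \<Rightarrow> ('v \<times> 'v) set \<Rightarrow> (nat \<Rightarrow> 'v) \<Rightarrow> bool" where
  "robber_walk V E w \<longleftrightarrow> w 0 \<in> V \<and> (\<forall>t. w (Suc t) = w t \<or> (w t, w (Suc t)) \<in> E)"

text \<open>
  A strategy maps the answers received so far (one list of distances per round, oldest first) to
  the list of vertices probed next. The cops need not move along edges and may share a vertex.
\<close>

type_synonym 'v cop_strategy = "nat list list \<Rightarrow> 'v list"

definition legal_strategy :: "'v set \<Rightarrow> nat \<Rightarrow> 'v cop_strategy \<Rightarrow> bool" where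
  "legal_strategy V m \<sigma> \<longleftrightarrow> (\<forall>h. length (\<sigma> h) = m \<and> set (\<sigma> h) \<subseteq> V)"

text \<open>\<open>answers E \<sigma> w t\<close> lists the answers in rounds \<open>0, \<dots>, t - 1\<close> against the robber walk \<open>w\<close>.\<close>

primrec answers ::
  "('v \<times> 'v) set \<Rightarrow> 'v cop_strategy \<Rightarrow> (nat \<Rightarrow> 'v) \<Rightarrow> nat \<Rightarrow> nat list list" where
  "answers E \<sigma> w 0 = []"
| "answers E \<sigma> w (Suc t) =
     answers E \<sigma> w t @ [map (\<lambda>c. graph_dist E c (w t)) (\<sigma> (answers E \<sigma> w t))]"

text \<open>
  The robber is located in round \<open>t\<close> if all robber walks giving the same answers in rounds
  \<open>0, \<dots>, t\<close> are at the same vertex in round \<open>t\<close>. Quantifying over all walks after the strategy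
  is fixed expresses that the robber knows the strategy.
\<close>

definition locates_at ::
  "'v set \<Rightarrow> ('v \<times> 'v) set \<Rightarrow> 'v cop_strategy \<Rightarrow> (nat \<Rightarrow> 'v) \<Rightarrow> nat \<Rightarrow> bool" where
  "locates_at V E \<sigma> w t \<longleftrightarrow>
     (\<forall>w'. robber_walk V E w' \<and> answers E \<sigma> w' (Suc t) = answers E \<sigma> w (Suc t) \<longrightarrow> w' t = w t)"

definition cops_win :: "'v set \<Rightarrow> ('v \<times> 'v) set \<Rightarrow> nat \<Rightarrow> bool" where
  "cops_win V E m \<longleftrightarrow>
     (\<exists>\<sigma>. legal_strategy V m \<sigma> \<and> (\<forall>w. robber_walk V E w \<longrightarrow> (\<exists>t. locates_at V E \<sigma> w t)))"

definition localization_number :: "'v set \<Rightarrow> ('v \<times> 'v) set \<Rightarrow> nat" where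
  "localization_number V E = (LEAST m. cops_win V E m)"

lemma incidence_edges_subset:
  "incidence_edges X \<B> \<subseteq> incidence_verts X \<B> \<times> incidence_verts X \<B>"
  by (auto simp: incidence_edges_def incidence_verts_def)

lemma sym_incidence_edges: "sym (incidence_edges X \<B>)"
  by (auto simp: incidence_edges_def sym_def)

lemma irrefl_incidence_edges: "irrefl (incidence_edges X \<B>)"
  by (auto simp: incidence_edges_def irrefl_def)

lemma incidence_connected:
  assumes td: "transversal_design k n X \<G> \<B>" and k: "k \<ge> 2"
    and u: "u \<in> incidence_verts X \<B>" and v: "v \<in> incidence_verts X \<B>"
  shows "(u, v) \<in> (incidence_edges X \<B>)\<^sup>*"
proof -
  let ?E = "incidence_edges X \<B>"
  have symE: "(b, a) \<in> ?E\<^sup>*" if "(a, b) \<in> ?E\<^sup>*" for a b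
    using symD[OF sym_rtrancl[OF sym_incidence_edges] that] .
  have part: "partition_on X \<G>" and cG: "card \<G> = k"
    using td by (auto simp: transversal_design_def)
  have diff: "(Inl x, Inl y) \<in> ?E\<^sup>*"
    if "G \<in> \<G>" "H \<in> \<G>" "G \<noteq> H" "x \<in> G" "y \<in> H" for G H x y
  proof -
    have "\<exists>!B. B \<in> \<B> \<and> x \<in> B \<and> y \<in> B"
      using td that by (simp add: transversal_design_def)
    then obtain B where B: "B \<in> \<B>" "x \<in> B" "y \<in> B" by blast
    moreover have "x \<in> X" "y \<in> X" using part that by (auto simp: partition_on_def)
    ultimately have "(Inl x, Inr B) \<in> ?E" "(Inr B, Inl y) \<in> ?E"
      by (auto simp: incidence_edges_def)
    then show ?thesis by (rule converse_rtrancl_into_rtrancl[OF _ r_into_rtrancl])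
  qed
  have pts: "(Inl x, Inl y) \<in> ?E\<^sup>*" if xy: "x \<in> X" "y \<in> X" for x y
  proof -
    obtain G H where GH: "G \<in> \<G>" "H \<in> \<G>" "x \<in> G" "y \<in> H"
      using partition_onD1[OF part] xy by blast
    show ?thesis
    proof (cases "G = H")
      case False
      then show ?thesis using diff GH by blast
    next
      case True
      have "\<not> \<G> \<subseteq> {G}" using cG k card_mono[of "{G}" \<G>] by auto
      then obtain K where K: "K \<in> \<G>" "K \<noteq> G" by blast
      then obtain z where "z \<in> K" using partition_onD3[OF part] by (metis all_not_in_conv)
      then have "(Inl x, Inl z) \<in> ?E\<^sup>*" "(Inl z, Inl y) \<in> ?E\<^sup>*"
        using diff[of G K x z] diff[of K H z y] GH K True by auto
      then show ?thesis by (rule rtrancl_trans)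
    qed
  qed
  have to_pt: "\<exists>x\<in>X. (a, Inl x) \<in> ?E\<^sup>*" if a: "a \<in> incidence_verts X \<B>" for a
  proof (cases a)
    case (Inl x)
    then show ?thesis using a by (auto simp: incidence_verts_def)
  next
    case (Inr B)
    then have B: "B \<in> \<B>" using a by (auto simp: incidence_verts_def)
    then have "B \<subseteq> X" "card B = k" using td by (auto simp: transversal_design_def)
    then obtain x where "x \<in> B" "x \<in> X" using k by (cases "B = {}") auto
    then have "(a, Inl x) \<in> ?E" using B Inr by (auto simp: incidence_edges_def)
    then show ?thesis using \<open>x \<in> X\<close> by blast
  qed
  obtain x where x: "x \<in> X" "(u, Inl x) \<in> ?E\<^sup>*" using to_pt[OF u] by blast
  obtain y where y: "y \<in> X" "(v, Inl y) \<in> ?E\<^sup>*" using to_pt[OF v] by blast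
  show ?thesis
    using rtrancl_trans[OF rtrancl_trans[OF x(2) pts[OF x(1) y(1)]] symE[OF y(2)]] .
qed

text \<open>So for a finite connected graph the minimum defining \<^const>\<open>localization_number\<close> exists.\<close>

lemma cops_win_card:
  assumes fin: "finite V" and EV: "E \<subseteq> V \<times> V"
    and conn: "\<And>u v. u \<in> V \<Longrightarrow> v \<in> V \<Longrightarrow> (u, v) \<in> E\<^sup>*"
  shows "cops_win V E (card V)"
proof -
  obtain xs where xs: "set xs = V" "distinct xs" using finite_distinct_list[OF fin] by blast
  have dist0: "graph_dist E u u = 0" for u
    unfolding graph_dist_def by (rule Least_eq_0) simp
  have distD: "u = v" if uv: "u \<in> V" "v \<in> V" and d0: "graph_dist E u v = 0" for u v
  proof -
    obtain d where "(u, v) \<in> E ^^ d" using conn[OF uv] rtrancl_power by blast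
    then have "(u, v) \<in> E ^^ graph_dist E u v" unfolding graph_dist_def by (rule LeastI)
    then show ?thesis using d0 by simp
  qed
  have "locates_at V E (\<lambda>_. xs) w 0" if w: "robber_walk V E w" for w
    unfolding locates_at_def
  proof (intro allI impI)
    fix w'
    assume a: "robber_walk V E w' \<and>
      answers E (\<lambda>_. xs) w' (Suc 0) = answers E (\<lambda>_. xs) w (Suc 0)"
    have inV: "w 0 \<in> V" "w' 0 \<in> V" using w a by (auto simp: robber_walk_def)
    have "\<forall>c\<in>V. graph_dist E c (w' 0) = graph_dist E c (w 0)" using a xs by auto
    then have "graph_dist E (w 0) (w' 0) = 0" using inV dist0 by simp
    then show "w' 0 = w 0" using distD inV by metis
  qed
  moreover have "legal_strategy V (card V) (\<lambda>_. xs)"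
    using xs distinct_card[OF xs(2)] by (simp add: legal_strategy_def)
  ultimately show ?thesis unfolding cops_win_def by blast
qed

end

theory Submission
  imports Defs "HOL-Library.Countable_Set"
begin

text \<open>
  Distances to a point reveal whether the robber is on a point or on a block. In round \<open>i\<close> the cops
  probe all points but one of a group \<open>G\<close>, and \<open>k - 3\<close> points \<open>C\<close> of another group, where \<open>G\<close> runs
  through all groups. A robber who always sits on points never moves, and is located when his group
  comes up. If he is on a block \<open>B\<close>, then the point \<open>p\<close> of \<open>B\<close> in \<open>G\<close> becomes known, and the
  remaining candidates are the at most \<open>n - k + 3\<close> blocks through \<open>p\<close> that miss \<open>C\<close>. After his next
  move he is on one of these blocks or on a point of one of them. Probing the points of \<open>B\<close> other
  than \<open>p\<close> and all candidate blocks except \<open>B\<close> and one more locates him: the points of \<open>B\<close> reveal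
  the group, the blocks reveal the block. This takes only \<open>(k - 1) + (n - k + 1) = n\<close> cops.
\<close>

section \<open>Two-phase strategies\<close>

text \<open>A set stands for a list of \<open>m\<close> probes: cops may share a vertex, so a
  nonempty set with at most \<open>m\<close> elements can be padded by repetition.\<close>

definition probe :: "'v set \<Rightarrow> nat \<Rightarrow> 'v set \<Rightarrow> bool" where
  "probe V m P \<longleftrightarrow> P \<subseteq> V \<and> finite P \<and> P \<noteq> {} \<and> card P \<le> m"

definition agree :: "('v \<times> 'v) set \<Rightarrow> 'v set \<Rightarrow> 'v \<Rightarrow> 'v \<Rightarrow> bool" where
  "agree E P u v \<longleftrightarrow> (\<forall>c\<in>P. graph_dist E c u = graph_dist E c v)"

lemma agree_sym: "agree E P u v \<Longrightarrow> agree E P v u"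
  by (simp add: agree_def)

text \<open>The closed neighbourhood of \<open>S\<close>: where the robber can be one round after
  being in \<open>S\<close>.\<close>

definition reach :: "('v \<times> 'v) set \<Rightarrow> 'v set \<Rightarrow> 'v set" where
  "reach E S = S \<union> E `` S"

lemma probe_list:
  assumes "probe V m P"
  obtains xs where "set xs = P" "length xs = m"
proof -
  obtain ys where ys: "set ys = P" "distinct ys"
    using finite_distinct_list assms by (auto simp: probe_def)
  then have "length ys \<le> m" "ys \<noteq> []"
    using assms distinct_card[of ys] by (auto simp: probe_def)
  then have "set (replicate (m - length ys) (hd ys) @ ys) = P"
    "length (replicate (m - length ys) (hd ys) @ ys) = m"
    using ys by auto
  then show thesis using that by blast
qed

lemma answers_prefix:
  assumes "answers E \<sigma> w t = answers E \<sigma> w' t" "s \<le> t"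
  shows "answers E \<sigma> w s = answers E \<sigma> w' s"
  using assms(2,1) by (induction rule: dec_induct) auto

lemma length_answers [simp]: "length (answers E \<sigma> w t) = t"
  by (induction t) auto

lemma robber_walk_in_verts:
  assumes "robber_walk V E w" "E \<subseteq> V \<times> V"
  shows "w t \<in> V"
proof (induction t)
  case 0
  show ?case using assms(1) by (simp add: robber_walk_def)
next
  case (Suc t)
  have "w (Suc t) = w t \<or> (w t, w (Suc t)) \<in> E" using assms(1) by (simp add: robber_walk_def)
  then show ?case using Suc assms(2) by auto
qed

text \<open>The cops probe \<open>P 0\<close>, \<open>P 1\<close>, ... until an answer admits a
  follow-up \<open>Q\<close> that separates all vertices reachable afterwards; then \<open>Q\<close>
  locates the robber. If no answer does, a robber outside \<open>T\<close> is located at once by the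
  first alternative of \<open>outside\<close>. A robber who never leaves \<open>T\<close> cannot
  move, as \<open>T\<close> is independent, so \<open>inside\<close> catches him in round
  \<open>i\<close>.\<close>

lemma cops_win_two_phase:
  fixes P :: "nat \<Rightarrow> 'v set"
  assumes EV: "E \<subseteq> V \<times> V"
    and P: "\<And>i. probe V m (P i)"
    and outside: "\<And>i u. u \<in> V - T \<Longrightarrow>
      (\<forall>v\<in>V. agree E (P i) u v \<longrightarrow> v = u) \<or>
      (\<exists>Q. probe V m Q \<and>
        (\<forall>x\<in>reach E {v \<in> V. agree E (P i) u v}. \<forall>y\<in>reach E {v \<in> V. agree E (P i) u v}.
           agree E Q x y \<longrightarrow> x = y))"
    and inside: "\<And>u. u \<in> T \<Longrightarrow> \<exists>i. \<forall>v\<in>V. agree E (P i) u v \<longrightarrow> v = u"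
    and indep: "\<And>u v. u \<in> T \<Longrightarrow> v \<in> T \<Longrightarrow> (u, v) \<notin> E"
  shows "cops_win V E m"
proof -
  obtain p where p: "\<And>i. set (p i) = P i" "\<And>i. length (p i) = m"
  proof -
    have "\<forall>i. \<exists>xs. set xs = P i \<and> length xs = m" using probe_list[OF P] by metis
    then show thesis using that by metis
  qed
  define ans where "ans xs v = map (\<lambda>c. graph_dist E c v) xs" for xs v
  have ans_iff: "ans xs u = ans xs v \<longleftrightarrow> agree E (set xs) u v" for xs u v
    by (auto simp: ans_def agree_def)
  \<comment> \<open>The condition depends on the answer \<open>a\<close>, not on the robber's
    vertex, because a strategy sees only answers.\<close>
  define good where "good i a q \<longleftrightarrow> set q \<subseteq> V \<and> length q = m \<and>
    (\<forall>x\<in>reach E {v \<in> V. ans (p i) v = a}. \<forall>y\<in>reach E {v \<in> V. ans (p i) v = a}.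
       ans q x = ans q y \<longrightarrow> x = y)" for i a q
  \<comment> \<open>The last round has index \<open>length h - 1\<close>. Its answer is read as a
    reply to \<open>p (length h - 1)\<close>, which is correct up to the first follow-up; that
    follow-up locates the robber, so later probes no longer matter.\<close>
  define \<sigma> where "\<sigma> h = (if h \<noteq> [] \<and> (\<exists>q. good (length h - 1) (last h) q)
    then SOME q. good (length h - 1) (last h) q else p (length h))" for h
  have \<sigma>_good: "good (length h - 1) (last h) (\<sigma> h)"
    if "h \<noteq> []" "\<exists>q. good (length h - 1) (last h) q" for h
    using that someI_ex[of "good (length h - 1) (last h)"] by (simp add: \<sigma>_def)
  have \<sigma>_bad: "\<sigma> h = p (length h)" if "\<nexists>q. good (length h - 1) (last h) q" for h
    using that by (simp add: \<sigma>_def)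
  have \<sigma>_Nil: "\<sigma> [] = p 0" by (simp add: \<sigma>_def)
  have legal: "legal_strategy V m \<sigma>"
    unfolding legal_strategy_def
  proof
    fix h
    show "length (\<sigma> h) = m \<and> set (\<sigma> h) \<subseteq> V"
    proof (cases "h \<noteq> [] \<and> (\<exists>q. good (length h - 1) (last h) q)")
      case True
      then show ?thesis using \<sigma>_good unfolding good_def by blast
    next
      case False
      then have "\<sigma> h = p (length h)" using \<sigma>_bad \<sigma>_Nil by (cases h) auto
      then show ?thesis using p P by (simp add: probe_def)
    qed
  qed
  have last_ans: "last (answers E \<sigma> w (Suc t)) = ans (\<sigma> (answers E \<sigma> w t)) (w t)" for w t
    by (simp add: ans_def)
  have phase1: "\<sigma> (answers E \<sigma> w t) = p t"
    if "\<And>s. s < t \<Longrightarrow> \<nexists>q. good s (ans (p s) (w s)) q" for w t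
    using that
  proof (induction t)
    case 0
    then show ?case by (simp add: \<sigma>_Nil)
  next
    case (Suc t)
    then have "\<sigma> (answers E \<sigma> w t) = p t" by simp
    then have "last (answers E \<sigma> w (Suc t)) = ans (p t) (w t)"
      by (simp only: last_ans)
    then have "\<nexists>q. good (length (answers E \<sigma> w (Suc t)) - 1) (last (answers E \<sigma> w (Suc t))) q"
      using Suc.prems[of t] by simp
    then show ?case using \<sigma>_bad by (metis length_answers)
  qed
  have "\<exists>t. locates_at V E \<sigma> w t" if w: "robber_walk V E w" for w
  proof (cases "\<exists>t q. good t (ans (p t) (w t)) q")
    case True
    \<comment> \<open>Taking the first such round guarantees, by \<open>phase1\<close>, that
      \<open>p t\<close> was really probed in it.\<close>
    define t where "t = (LEAST t. \<exists>q. good t (ans (p t) (w t)) q)"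
    have ex: "\<exists>q. good t (ans (p t) (w t)) q"
      using LeastI_ex[OF True] unfolding t_def .
    have "\<nexists>q. good s (ans (p s) (w s)) q" if "s < t" for s
      using not_less_Least that unfolding t_def by blast
    then have \<sigma>t: "\<sigma> (answers E \<sigma> w t) = p t" by (rule phase1)
    define a where "a = ans (p t) (w t)"
    define h where "h = answers E \<sigma> w (Suc t)"
    have h: "h \<noteq> []" "length h - 1 = t" "last h = a"
      using last_ans[of w t] \<sigma>t length_answers[of E \<sigma> w "Suc t"]
      by (auto simp: h_def a_def simp del: length_answers)
    then have gq: "good t a (\<sigma> h)"
      using ex \<sigma>_good[of h] by (simp add: a_def)
    have step: "w' (Suc t) \<in> reach E {v \<in> V. ans (p t) v = a}"
      if "robber_walk V E w'" "ans (p t) (w' t) = a" for w'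
    proof -
      have "w' t \<in> {v \<in> V. ans (p t) v = a}"
        using that robber_walk_in_verts[OF that(1) EV, of t] by simp
      moreover have "w' (Suc t) = w' t \<or> (w' t, w' (Suc t)) \<in> E"
        using that by (simp add: robber_walk_def)
      ultimately show ?thesis unfolding reach_def by (metis ImageI UnI1 UnI2)
    qed
    have "locates_at V E \<sigma> w (Suc t)"
      unfolding locates_at_def
    proof (intro allI impI)
      fix w'
      assume *: "robber_walk V E w' \<and>
        answers E \<sigma> w' (Suc (Suc t)) = answers E \<sigma> w (Suc (Suc t))"
      then have h': "answers E \<sigma> w' (Suc t) = h"
        using answers_prefix[OF conjunct2[OF *], of "Suc t"] unfolding h_def by simp
      have "answers E \<sigma> w' t = answers E \<sigma> w t"
        using answers_prefix[OF conjunct2[OF *], of t] by simp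
      then have "ans (p t) (w' t) = a"
        using last_ans[of w' t] unfolding h' h(3) by (metis \<sigma>t)
      moreover have "ans (\<sigma> h) (w' (Suc t)) = ans (\<sigma> h) (w (Suc t))"
        using conjunct2[OF *] last_ans[of w' "Suc t"] last_ans[of w "Suc t"] h'
        unfolding h_def by metis
      ultimately show "w' (Suc t) = w (Suc t)"
        using gq step[of w'] step[of w] w * unfolding good_def a_def by blast
    qed
    then show ?thesis by blast
  next
    case False
    \<comment> \<open>With no follow-up ever available, the cops stay in the first phase
      forever.\<close>
    have \<sigma>p: "\<sigma> (answers E \<sigma> w t) = p t" for t
      using phase1 False by blast
    have located: "locates_at V E \<sigma> w t"
      if "\<forall>v\<in>V. agree E (P t) (w t) v \<longrightarrow> v = w t" for t
      unfolding locates_at_def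
    proof (intro allI impI)
      fix w'
      assume *: "robber_walk V E w' \<and> answers E \<sigma> w' (Suc t) = answers E \<sigma> w (Suc t)"
      then have "answers E \<sigma> w' t = answers E \<sigma> w t" by simp
      then have "ans (p t) (w t) = ans (p t) (w' t)"
        using conjunct2[OF *] last_ans[of w' t] last_ans[of w t] \<sigma>p by metis
      then show "w' t = w t"
        using that robber_walk_in_verts[of V E w' t] * EV p by (simp add: ans_iff)
    qed
    show ?thesis
    proof (cases "\<exists>t. w t \<notin> T")
      case True
      then obtain t where t: "w t \<in> V - T" using robber_walk_in_verts[OF w EV] by blast
      \<comment> \<open>A probe \<open>Q\<close> as in the second alternative of
        \<open>outside\<close> would yield a \<open>good\<close> follow-up, which this case
        excludes; so the first alternative must hold.\<close>
      have "\<not> (\<exists>Q. probe V m Q \<and>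
        (\<forall>x\<in>reach E {v \<in> V. agree E (P t) (w t) v}.
         \<forall>y\<in>reach E {v \<in> V. agree E (P t) (w t) v}. agree E Q x y \<longrightarrow> x = y))"
      proof
        assume "\<exists>Q. probe V m Q \<and>
          (\<forall>x\<in>reach E {v \<in> V. agree E (P t) (w t) v}.
           \<forall>y\<in>reach E {v \<in> V. agree E (P t) (w t) v}. agree E Q x y \<longrightarrow> x = y)"
        then obtain Q where Q: "probe V m Q"
          "\<forall>x\<in>reach E {v \<in> V. agree E (P t) (w t) v}.
           \<forall>y\<in>reach E {v \<in> V. agree E (P t) (w t) v}. agree E Q x y \<longrightarrow> x = y"
          by blast
        obtain q where q: "set q = Q" "length q = m" using probe_list[OF Q(1)] .
        have "{v \<in> V. ans (p t) v = ans (p t) (w t)} = {v \<in> V. agree E (P t) (w t) v}"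
          using agree_sym by (auto simp: ans_iff p)
        then have "good t (ans (p t) (w t)) q"
          using Q q by (simp add: good_def ans_iff probe_def)
        then show False using False by blast
      qed
      then show ?thesis using outside[OF t, of t] located by blast
    next
      case inT: False
      have "w t = w 0" for t
      proof (induction t)
        case (Suc t)
        then show ?case using w indep inT unfolding robber_walk_def by metis
      qed simp
      moreover obtain i where "\<forall>v\<in>V. agree E (P i) (w 0) v \<longrightarrow> v = w 0"
        using inside inT by blast
      ultimately show ?thesis using located[of i] by metis
    qed
  qed
  then show ?thesis using legal unfolding cops_win_def by blast
qed

section \<open>Distances in the incidence graph\<close>

locale td =
  fixes k n :: nat and X :: "'a set" and \<G> \<B> :: "'a set set"
  assumes td: "transversal_design k n X \<G> \<B>" and k_ge_2: "k \<ge> 2"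
begin

abbreviation "V \<equiv> incidence_verts X \<B>"
abbreviation "E \<equiv> incidence_edges X \<B>"
abbreviation "d \<equiv> graph_dist E"

section \<open>Elementary facts on groups and blocks\<close>

lemma finite_points: "finite X" and groups: "partition_on X \<G>" "card \<G> = k"
  and card_group: "G \<in> \<G> \<Longrightarrow> card G = n"
  and block: "B \<in> \<B> \<Longrightarrow> B \<subseteq> X" "B \<in> \<B> \<Longrightarrow> card B = k"
  and card_block_group: "B \<in> \<B> \<Longrightarrow> G \<in> \<G> \<Longrightarrow> card (B \<inter> G) = 1"
  using td by (simp_all add: transversal_design_def)

lemma block_ex1:
  "\<lbrakk>G \<in> \<G>; H \<in> \<G>; G \<noteq> H; x \<in> G; y \<in> H\<rbrakk> \<Longrightarrow> \<exists>!B. B \<in> \<B> \<and> x \<in> B \<and> y \<in> B"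
  using td by (simp add: transversal_design_def)

lemma finite_groups: "finite \<G>"
  using groups(2) k_ge_2 by (metis card.infinite not_numeral_le_zero)

lemma group_subset: "G \<in> \<G> \<Longrightarrow> G \<subseteq> X"
  using partition_onD1[OF groups(1)] by blast

lemma finite_group: "G \<in> \<G> \<Longrightarrow> finite G"
  using group_subset finite_points finite_subset by blast

lemma n_pos: "n > 0"
proof -
  obtain G where G: "G \<in> \<G>" using groups(2) k_ge_2 by fastforce
  then have "G \<noteq> {}" using partition_onD3[OF groups(1)] by blast
  then show ?thesis using card_group[OF G] finite_group[OF G] by (metis card_gt_0_iff)
qed

lemma finite_blocks: "finite \<B>"
  using block(1) finite_points by (intro finite_subset[of \<B> "Pow X"]) auto

lemma point_group: "x \<in> X \<Longrightarrow> \<exists>G\<in>\<G>. x \<in> G"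
  using partition_onD1[OF groups(1)] by blast

lemma group_unique: "\<lbrakk>G \<in> \<G>; H \<in> \<G>; x \<in> G; x \<in> H\<rbrakk> \<Longrightarrow> G = H"
  using partition_onD2[OF groups(1)] by (auto dest: disjointD)

lemma block_meets_group:
  assumes "B \<in> \<B>" "G \<in> \<G>"
  obtains x where "B \<inter> G = {x}"
  using card_block_group[OF assms] card_1_singletonE by blast

lemma block_group_eq: "\<lbrakk>B \<in> \<B>; G \<in> \<G>; x \<in> B; x \<in> G; y \<in> B; y \<in> G\<rbrakk> \<Longrightarrow> x = y"
  by (metis IntI block_meets_group singletonD)

lemma block_eq:
  "\<lbrakk>G \<in> \<G>; H \<in> \<G>; G \<noteq> H; x \<in> G; y \<in> H; B \<in> \<B>; x \<in> B; y \<in> B; B' \<in> \<B>; x \<in> B'; y \<in> B'\<rbrakk>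
    \<Longrightarrow> B = B'"
  using block_ex1[of G H x y] by blast

section \<open>Parity of distances, and the distances 0, 1 and 2\<close>

lemma dist_walk:
  assumes "u \<in> V" "v \<in> V"
  shows "(u, v) \<in> E ^^ d u v"
proof -
  obtain l where "(u, v) \<in> E ^^ l"
    using incidence_connected[OF td k_ge_2 assms] rtrancl_power by blast
  then show ?thesis unfolding graph_dist_def by (rule LeastI)
qed

lemma dist_le: "(u, v) \<in> E ^^ l \<Longrightarrow> d u v \<le> l"
  unfolding graph_dist_def by (rule Least_le)

lemma dist_0: "\<lbrakk>u \<in> V; v \<in> V\<rbrakk> \<Longrightarrow> d u v = 0 \<longleftrightarrow> u = v"
  using dist_walk[of u v] dist_le[of u v 0] by auto

lemma dist_1:
  assumes "u \<in> V" "v \<in> V"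
  shows "d u v = 1 \<longleftrightarrow> (u, v) \<in> E"
proof
  assume "d u v = 1"
  then show "(u, v) \<in> E" using dist_walk[OF assms] by simp
next
  assume e: "(u, v) \<in> E"
  then have "u \<noteq> v" using irrefl_incidence_edges by (auto simp: irrefl_def)
  then show "d u v = 1" using dist_le[of u v 1] dist_0[OF assms] e by simp
qed

text \<open>Every edge switches between points and blocks.\<close>

lemma even_walk: "(u, v) \<in> E ^^ l \<Longrightarrow> even l \<longleftrightarrow> isl u = isl v"
proof (induction l arbitrary: v)
  case (Suc l)
  then obtain z where "(u, z) \<in> E ^^ l" "(z, v) \<in> E" by auto
  then show ?case using Suc.IH[of z] by (auto simp: incidence_edges_def)
qed simp

lemma even_dist: "\<lbrakk>u \<in> V; v \<in> V\<rbrakk> \<Longrightarrow> even (d u v) \<longleftrightarrow> isl u = isl v"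
  by (rule even_walk[OF dist_walk])

text \<open>A walk of length two between points passes through a common block. Points of different
  groups have one; distinct points of one group have none, as a block meets a group only
  once.\<close>

lemma dist_points:
  assumes x: "x \<in> X" and y: "y \<in> X"
  shows "d (Inl x) (Inl y) = 2 \<longleftrightarrow> \<not> (\<exists>G\<in>\<G>. x \<in> G \<and> y \<in> G)"
proof -
  have V: "Inl x \<in> V" "Inl y \<in> V" using x y by (auto simp: incidence_verts_def)
  have walk: "(Inl x, Inl y) \<in> E ^^ 2 \<longleftrightarrow> (\<exists>B\<in>\<B>. x \<in> B \<and> y \<in> B)"
    using x y by (auto simp: incidence_edges_def numeral_2_eq_2 relcomp_unfold)
  show ?thesis
  proof
    assume d2: "d (Inl x) (Inl y) = 2"
    then obtain B where "B \<in> \<B>" "x \<in> B" "y \<in> B" using walk dist_walk[OF V] by auto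
    moreover have "x \<noteq> y" using d2 dist_0[OF V] by auto
    ultimately show "\<not> (\<exists>G\<in>\<G>. x \<in> G \<and> y \<in> G)" using block_group_eq by blast
  next
    assume nG: "\<not> (\<exists>G\<in>\<G>. x \<in> G \<and> y \<in> G)"
    obtain G H where GH: "G \<in> \<G>" "H \<in> \<G>" "x \<in> G" "y \<in> H"
      using point_group x y by metis
    then have "d (Inl x) (Inl y) \<le> 2"
      using block_ex1[of G H x y] nG walk dist_le by blast
    moreover have "x \<noteq> y" using GH nG by blast
    \<comment> \<open>Parity excludes distance 1, and \<open>x \<noteq> y\<close> excludes
      0.\<close>
    moreover have "even (d (Inl x) (Inl y))" using even_dist[OF V] by simp
    ultimately show "d (Inl x) (Inl y) = 2" using dist_0[OF V]
      by (auto simp: le_Suc_eq numeral_2_eq_2)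
  qed
qed

section \<open>What equal answers to a probe reveal\<close>

lemma agree_point:
  assumes "agree E P u v" "Inl x \<in> P" "x \<in> X" "u \<in> V" "v \<in> V"
  shows "isl u = isl v"
    and "u = Inl x \<longleftrightarrow> v = Inl x"
    and "(Inl x, u) \<in> E \<longleftrightarrow> (Inl x, v) \<in> E"
proof -
  have x: "Inl x \<in> V" and eq: "d (Inl x) u = d (Inl x) v"
    using assms by (auto simp: incidence_verts_def agree_def)
  show "isl u = isl v" using even_dist[OF x assms(4)] even_dist[OF x assms(5)] eq by auto
  show "u = Inl x \<longleftrightarrow> v = Inl x" using dist_0[OF x] assms(4,5) eq by metis
  show "(Inl x, u) \<in> E \<longleftrightarrow> (Inl x, v) \<in> E" using dist_1[OF x assms(4)] dist_1[OF x assms(5)] eq by simp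
qed

lemma agree_incident:
  assumes "agree E P (Inr B) (Inr D)" "Inl x \<in> P" "x \<in> X" "B \<in> \<B>" "D \<in> \<B>"
  shows "x \<in> B \<longleftrightarrow> x \<in> D"
proof -
  have "(Inl x, Inr B) \<in> E \<longleftrightarrow> (Inl x, Inr D) \<in> E"
    using assms by (intro agree_point(3)) (auto simp: incidence_verts_def)
  then show ?thesis using assms by (auto simp: incidence_edges_def)
qed

lemma agree_block:
  assumes "agree E P u v" "Inr B \<in> P" "B \<in> \<B>" "u \<in> V" "v \<in> V"
  shows "u = Inr B \<longleftrightarrow> v = Inr B"
    and "(Inr B, u) \<in> E \<longleftrightarrow> (Inr B, v) \<in> E"
proof -
  have B: "Inr B \<in> V" and eq: "d (Inr B) u = d (Inr B) v"
    using assms by (auto simp: incidence_verts_def agree_def)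
  show "u = Inr B \<longleftrightarrow> v = Inr B" using dist_0[OF B] assms(4,5) eq by metis
  show "(Inr B, u) \<in> E \<longleftrightarrow> (Inr B, v) \<in> E" using dist_1[OF B assms(4)] dist_1[OF B assms(5)] eq by simp
qed

text \<open>Distance 2 is the signature of different groups, so one probed point suffices to test
  membership in its group.\<close>

lemma agree_same_group:
  assumes "agree E P (Inl u) (Inl v)" "Inl x \<in> P" "x \<in> X" "u \<in> X" "v \<in> X" "G \<in> \<G>" "x \<in> G"
  shows "u \<in> G \<longleftrightarrow> v \<in> G"
proof -
  have "d (Inl x) (Inl u) = d (Inl x) (Inl v)" using assms by (simp add: agree_def)
  then have "(\<exists>G\<in>\<G>. x \<in> G \<and> u \<in> G) \<longleftrightarrow> (\<exists>G\<in>\<G>. x \<in> G \<and> v \<in> G)"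
    using dist_points assms by metis
  then show ?thesis using group_unique[OF assms(6) _ assms(7)] assms(6,7) by blast
qed

section \<open>Locating the robber\<close>

text \<open>A probe in \<open>A\<close> shows by parity that \<open>v\<close> is a point, and by
  \<open>agree_same_group\<close> that this point lies in \<open>G\<close>. A probed point is
  recognised by distance 0, and at most one point of \<open>G\<close> is unprobed.\<close>

lemma probe_group_locates_point:
  assumes G: "G \<in> \<G>" and A: "A \<subseteq> G" "A \<noteq> {}" "card (G - A) \<le> 1" "Inl ` A \<subseteq> P"
    and x: "x \<in> G" and v: "v \<in> V" and ag: "agree E P (Inl x) v"
  shows "v = Inl x"
proof -
  obtain a where a: "a \<in> A" using A by blast
  have xV: "Inl x \<in> V" "x \<in> X" using x G group_subset by (auto simp: incidence_verts_def)
  have AX: "A \<subseteq> X" using A G group_subset by blast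
  have "Inl a \<in> P" "a \<in> X" using a A AX by auto
  then have "isl v" using agree_point(1)[OF ag _ _ xV(1) v] by simp
  then obtain y where y: "v = Inl y" "y \<in> X"
    using v by (auto simp: incidence_verts_def)
  show ?thesis
  proof (cases "x \<in> A \<or> y \<in> A")
    case True
    then show ?thesis
      using agree_point(2)[OF ag _ _ xV(1) v] A AX y by blast
  next
    case False
    have "y \<in> G"
      using agree_same_group[of P x y a G] ag y a A AX xV G x by blast
    then show ?thesis
      using False x y A(3) finite_group[OF G] by (auto simp: card_le_Suc0_iff_eq)
  qed
qed

text \<open>Each block has exactly one point in \<open>G\<close>. If one of the two traces is
  probed, incidence carries it over to the other block; otherwise both are the only point of
  \<open>G - A\<close>.\<close>

lemma probe_group_locates_trace:
  assumes G: "G \<in> \<G>" and A: "A \<subseteq> G" "card (G - A) \<le> 1" "Inl ` A \<subseteq> P"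
    and B: "B \<in> \<B>" "B' \<in> \<B>" and ag: "agree E P (Inr B) (Inr B')"
    and p: "p \<in> B" "p \<in> G"
  shows "p \<in> B'"
proof -
  have iff: "a \<in> B \<longleftrightarrow> a \<in> B'" if "a \<in> A" for a
    using agree_incident[OF ag _ _ B] that A G group_subset by blast
  obtain q where q: "q \<in> B'" "q \<in> G" using block_meets_group[OF B(2) G] by blast
  show ?thesis
  proof (cases "p \<in> A \<or> q \<in> A")
    case True
    then show ?thesis using iff p q block_group_eq[OF B(1) G] by metis
  next
    case False
    then have "p = q"
      using q p A(2) finite_group[OF G] by (auto simp: card_le_Suc0_iff_eq)
    then show ?thesis using q by simp
  qed
qed

text \<open>A block through \<open>p\<close> is determined by its point in \<open>H\<close>, since
  \<open>p\<close> lies in another group. For the blocks counted this point avoids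
  \<open>C\<close>.\<close>

lemma card_blocks_through_point_missing:
  assumes GH: "G \<in> \<G>" "H \<in> \<G>" "G \<noteq> H" and p: "p \<in> G" and C: "C \<subseteq> H"
  shows "card {B \<in> \<B>. p \<in> B \<and> B \<inter> C = {}} \<le> n - card C"
proof -
  define f where "f B = (THE x. x \<in> B \<inter> H)" for B
  have f: "f B \<in> B \<inter> H" if "B \<in> \<B>" for B
    using block_meets_group[OF that GH(2)] unfolding f_def by (metis singletonI theI singletonD)
  have "inj_on f {B \<in> \<B>. p \<in> B \<and> B \<inter> C = {}}"
    using f block_eq[OF GH p] by (intro inj_onI) (metis (no_types, lifting) Int_iff mem_Collect_eq)
  moreover have "f ` {B \<in> \<B>. p \<in> B \<and> B \<inter> C = {}} \<subseteq> H - C"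
    using f by blast
  moreover have "card (H - C) = n - card C"
    using card_Diff_subset[OF finite_subset[OF C] C] finite_group card_group GH by simp
  ultimately show ?thesis
    using card_inj_on_le[of f _ "H - C"] finite_group[OF GH(2)] by simp
qed

text \<open>
  Here \<open>L\<close> is the set of candidate blocks through \<open>p\<close>. The block \<open>B1\<close> is not probed: its points are
  those that are on no probed block and not on \<open>B\<close>.
\<close>

lemma probe_pencil_locates:
  assumes G: "G \<in> \<G>" and p: "p \<in> G" and L: "L \<subseteq> \<B>" "\<And>B. B \<in> L \<Longrightarrow> p \<in> B" and B: "B \<in> L"
    and k2: "k > 2"
    and Q: "Q = Inl ` (B - {p}) \<union> Inr ` (L - {B, B1})"
    and u: "u \<in> reach E (Inr ` L)" and v: "v \<in> reach E (Inr ` L)" and ag: "agree E Q u v"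
  shows "u = v"
proof -
  have BB: "B \<in> \<B>" using L B by blast
  have cand: "(\<exists>D\<in>L. w = Inr D) \<or> (\<exists>D\<in>L. \<exists>x\<in>D. x \<in> X \<and> w = Inl x)"
    if "w \<in> reach E (Inr ` L)" for w
    using that by (auto simp: reach_def incidence_edges_def)
  have inV: "w \<in> V" if "w \<in> reach E (Inr ` L)" for w
    using cand[OF that] L(1) by (auto simp: incidence_verts_def)
  note uV = inV[OF u] and vV = inV[OF v]
  have BX: "B \<subseteq> X" using block(1)[OF BB] .
  have "card (B - {p}) > 0" using block(2)[OF BB] k2 L(2)[OF B] by simp
  \<comment> \<open>This probed point separates points from blocks by parity, and also serves to
    recognise the unprobed block \<open>B\<close>.\<close>
  then obtain y where y: "y \<in> B" "y \<noteq> p" by (metis Diff_iff card_gt_0_iff equals0I insertCI)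
  have yQ: "Inl y \<in> Q" "y \<in> X" using y BX Q by auto
  have side: "isl u = isl v" using agree_point(1)[OF ag yQ uV vV] .
  show ?thesis
  proof (cases "isl u")
    case False
    then obtain D D' where D: "u = Inr D" "v = Inr D'" "D \<in> L" "D' \<in> L"
      using side cand[OF u] cand[OF v] by auto
    show ?thesis
    proof (cases "D \<in> L - {B, B1} \<or> D' \<in> L - {B, B1}")
      case True
      then show ?thesis
        using agree_block(1)[OF ag _ _ uV vV] D Q L(1) by blast
    next
      case rest: False
      \<comment> \<open>As \<open>y\<close> and \<open>p\<close> lie in different groups,
        \<open>B\<close> is the only block of \<open>L\<close> through \<open>y\<close>. The probe
        at \<open>y\<close> thus detects \<open>B\<close>, and \<open>B1\<close> is the only
        candidate left.\<close>
      obtain K where K: "K \<in> \<G>" "y \<in> K" using point_group yQ by blast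
      have "G \<noteq> K" using block_group_eq[OF BB G _ p y(1)] L(2)[OF B] K y by blast
      then have "D'' = B" if "D'' \<in> L" "y \<in> D''" for D''
        using block_eq[OF G K(1) _ p K(2), of D'' B] that y BB L B by blast
      moreover have "y \<in> D \<longleftrightarrow> y \<in> D'"
        using agree_incident[OF _ yQ] ag D L(1) by blast
      ultimately have "D = B \<longleftrightarrow> D' = B" using D y by blast
      then show ?thesis using rest D by blast
    qed
  next
    case True
    then obtain D D' x z where D: "D \<in> L" "D' \<in> L" "x \<in> D" "z \<in> D'" "x \<in> X" "z \<in> X"
      and uv: "u = Inl x" "v = Inl z"
      using side cand[OF u] cand[OF v] by auto
    \<comment> \<open>\<open>B\<close> meets every group, so each group except \<open>G\<close>
      contains a probed point.\<close>
    have same: "x \<in> K \<longleftrightarrow> z \<in> K" if K: "K \<in> \<G>" "K \<noteq> G" for K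
    proof -
      obtain c where c: "c \<in> B" "c \<in> K" using block_meets_group[OF BB K(1)] by blast
      then have "c \<noteq> p" using group_unique K G p by blast
      then show ?thesis
        using agree_same_group[of Q x z c K] ag uv c D K Q BX by blast
    qed
    obtain K where K: "K \<in> \<G>" "x \<in> K" using point_group D by blast
    have zK: "z \<in> K"
    proof (cases "K = G")
      case True
      \<comment> \<open>The group \<open>G\<close> is recognised by exclusion: if \<open>z\<close>
        were in another group, \<open>same\<close> would put \<open>x\<close> there too.\<close>
      obtain K' where K': "K' \<in> \<G>" "z \<in> K'" using point_group D by blast
      then show ?thesis using same[of K'] K True group_unique by metis
    qed (use same K in blast)
    show ?thesis
    proof (cases "K = G")
      case True
      \<comment> \<open>All candidate blocks pass through \<open>p\<close>, which is their only
        point in \<open>G\<close>.\<close>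
      then have "x = p" "z = p" using block_group_eq D K zK L p by blast+
      then show ?thesis using uv by simp
    next
      case False
      obtain c where c: "c \<in> B" "c \<in> K" using block_meets_group[OF BB K(1)] by blast
      then have "c \<noteq> p" using group_unique K G p False by blast
      then have cQ: "Inl c \<in> Q" "c \<in> X" using c Q BX by auto
      have on: "x \<in> F \<longleftrightarrow> z \<in> F" if "F \<in> L - {B, B1}" for F
        using agree_block(2)[OF ag _ _ uV vV, of F] that Q L(1) uv D
        by (auto simp: incidence_edges_def)
      show ?thesis
      proof (cases "x = c \<or> z = c")
        case True
        then show ?thesis using agree_point(2)[OF ag cQ uV vV] uv by blast
      next
        case nc: False
        then have "D \<noteq> B" "D' \<noteq> B"
          using block_group_eq[OF BB K(1) c] D K zK by blast+
        \<comment> \<open>Either \<open>D\<close> and \<open>D'\<close> are both \<open>B1\<close>,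
          or one of them is probed and \<open>on\<close> places both points on it. Since
          \<open>x\<close> and \<open>z\<close> share the group \<open>K\<close>, a common block
          forces them to be equal.\<close>
        then have "(x \<in> D \<and> z \<in> D) \<or> (x \<in> D' \<and> z \<in> D')"
          using on D by blast
        then have "x = z" using block_group_eq D L(1) K zK by blast
        then show ?thesis using uv by simp
      qed
    qed
  qed
qed

section \<open>The strategy for transversal designs and the count of its probes\<close>

lemma cops_win_incidence:
  assumes k4: "k \<ge> 4"
  shows "cops_win V E (n + k - 4)"
proof -
  define m where "m = n + k - 4"
  have "\<G> \<noteq> {}" using groups(2) k4 by auto
  \<comment> \<open>Every group need come up only once, since a robber who stays on points never
    moves.\<close>
  then obtain g :: "nat \<Rightarrow> 'a set" where g: "range g = \<G>"
    using finite_groups countable_finite range_from_nat_into by metis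
  have gG: "g i \<in> \<G>" for i using g by blast
  \<comment> \<open>The \<open>max\<close> keeps \<open>A\<close> nonempty when
    \<open>n = 1\<close>; the \<open>min\<close> caps \<open>C\<close> at \<open>n - 1\<close>,
    since the last point of a group can be inferred.\<close>
  have "\<exists>H A C. H \<in> \<G> \<and> H \<noteq> g i \<and> A \<subseteq> g i \<and> card A = max 1 (n - 1) \<and>
    C \<subseteq> H \<and> card C = min (k - 3) (n - 1)" for i
  proof -
    have "\<not> \<G> \<subseteq> {g i}" using groups(2) k4 card_mono[of "{g i}" \<G>] by auto
    then obtain H where H: "H \<in> \<G>" "H \<noteq> g i" by blast
    have "max 1 (n - 1) \<le> card (g i)" "min (k - 3) (n - 1) \<le> card H"
      using card_group gG H n_pos by auto
    then show ?thesis using H by (meson obtain_subset_with_card_n)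
  qed
  then obtain H A C where HAC: "\<And>i. H i \<in> \<G>" "\<And>i. H i \<noteq> g i"
    "\<And>i. A i \<subseteq> g i" "\<And>i. card (A i) = max 1 (n - 1)"
    "\<And>i. C i \<subseteq> H i" "\<And>i. card (C i) = min (k - 3) (n - 1)"
    by metis
  define P :: "nat \<Rightarrow> ('a + 'a set) set" where "P i = Inl ` (A i \<union> C i)" for i
  have fin: "finite (A i)" "finite (C i)" for i
    using HAC gG finite_group finite_subset by metis+
  have A_ne: "A i \<noteq> {}" for i using HAC(4)[of i] by auto
  have card_rest: "card (g i - A i) \<le> 1" for i
    using card_Diff_subset[OF fin(1) HAC(3)] HAC(4) card_group[OF gG] by simp
  have AP: "Inl ` A i \<subseteq> P i" "Inl ` C i \<subseteq> P i" for i by (auto simp: P_def)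
  have ACX: "A i \<union> C i \<subseteq> X" for i using HAC gG group_subset by blast
  have "cops_win V E m"
  proof (rule cops_win_two_phase[where P = P and T = "Inl ` X"])
    show "E \<subseteq> V \<times> V" by (rule incidence_edges_subset)
  next
    fix i
    have "card (P i) \<le> card (A i) + card (C i)"
      unfolding P_def using card_image_le card_Un_le fin by (metis finite_Un le_trans)
    \<comment> \<open>For \<open>n > 1\<close> the sum is at most
      \<open>(n - 1) + (k - 3) = m\<close>; for \<open>n = 1\<close> it is 1, and
      \<open>m = k - 3\<close> is at least 1.\<close>
    also have "\<dots> \<le> m" using HAC(4,6) n_pos k4 by (simp add: m_def)
    finally show "probe V m (P i)"
      using fin A_ne ACX[of i] by (auto simp: probe_def P_def incidence_verts_def)
  next
    fix u :: "'a + 'a set" assume "u \<in> Inl ` X"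
    then obtain x where x: "u = Inl x" "x \<in> X" by blast
    then obtain i where "x \<in> g i" using point_group g by (metis imageE)
    then show "\<exists>i. \<forall>v\<in>V. agree E (P i) u v \<longrightarrow> v = u"
      using probe_group_locates_point[OF gG HAC(3) A_ne card_rest AP(1)] x by blast
  next
    fix u v :: "'a + 'a set" assume "u \<in> Inl ` X" "v \<in> Inl ` X"
    then show "(u, v) \<notin> E" by (auto simp: incidence_edges_def)
  next
    fix i :: nat and u :: "'a + 'a set" assume u: "u \<in> V - Inl ` X"
    then obtain B where B: "u = Inr B" "B \<in> \<B>" by (auto simp: incidence_verts_def)
    obtain a where a: "a \<in> A i" using A_ne by blast
    obtain p where p: "p \<in> B" "p \<in> g i" using block_meets_group[OF B(2) gG[of i]] by blast
    obtain q where q: "q \<in> B" "q \<in> H i" using block_meets_group[OF B(2) HAC(1)[of i]] by blast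
    have same: "\<exists>D\<in>\<B>. v = Inr D \<and> p \<in> D \<and> agree E (P i) (Inr B) (Inr D)"
      if v: "v \<in> V" "agree E (P i) u v" for v
    proof -
      have "\<not> isl v"
        using agree_point(1)[OF v(2), of a] AP(1)[of i] ACX[of i] a v(1) u B by auto
      then obtain D where D: "v = Inr D" "D \<in> \<B>"
        using v by (auto simp: incidence_verts_def)
      then have "p \<in> D"
        using probe_group_locates_trace[OF gG HAC(3) card_rest AP(1) B(2) D(2) _ p] v B by blast
      then show ?thesis using D v B by blast
    qed
    have eqB: "D = B" if "D \<in> \<B>" "p \<in> D" "q \<in> D" for D
      using block_eq[OF gG HAC(1) HAC(2)[symmetric] p(2) q(2)] that B p q by blast
    show "(\<forall>v\<in>V. agree E (P i) u v \<longrightarrow> v = u) \<or>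
      (\<exists>Q. probe V m Q \<and>
        (\<forall>x\<in>reach E {v \<in> V. agree E (P i) u v}. \<forall>y\<in>reach E {v \<in> V. agree E (P i) u v}.
           agree E Q x y \<longrightarrow> x = y))" (is "?one \<or> ?two")
    \<comment> \<open>If \<open>q\<close> is probed, or \<open>C i\<close> omits just one point of
      \<open>H i\<close>, then \<open>q\<close> becomes known besides \<open>p\<close>. Two points
      in different groups determine \<open>B\<close>, so no second phase is needed.\<close>
    proof (cases "k - 3 < n - 1 \<and> q \<notin> C i")
      case False
      have "q \<in> D" if D: "D \<in> \<B>" "agree E (P i) (Inr B) (Inr D)" for D
      proof (cases "q \<in> C i")
        case True
        then show ?thesis
          using agree_incident[OF D(2) _ _ B(2) D(1)] AP(2) ACX q by blast
      next
        case nq: False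
        then have "card (H i - C i) \<le> 1"
          using False card_Diff_subset[OF fin(2) HAC(5)] HAC(6) card_group[OF HAC(1)] by simp
        then show ?thesis
          using probe_group_locates_trace[OF HAC(1) HAC(5) _ AP(2) B(2) D(1) D(2) q] by blast
      qed
      then have ?one using same eqB B by blast
      then show ?thesis ..
    next
      case True
      define L where "L = {D \<in> \<B>. p \<in> D \<and> D \<inter> C i = {}}"
      \<comment> \<open>The only point of \<open>B\<close> in \<open>H i\<close> is
        \<open>q\<close>, which is not in \<open>C i\<close>.\<close>
      have "B \<inter> C i = {}"
        using True q block_group_eq[OF B(2) HAC(1)] HAC(5)[of i] by blast
      then have BL: "B \<in> L" using B p by (simp add: L_def)
      have "D \<in> L" if D: "D \<in> \<B>" "p \<in> D" "agree E (P i) (Inr B) (Inr D)" for D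
      proof -
        have "c \<notin> D" if "c \<in> C i" for c
          using agree_incident[OF D(3) _ _ B(2) D(1)] AP(2) ACX that \<open>B \<inter> C i = {}\<close> by blast
        then show ?thesis using D by (auto simp: L_def)
      qed
      then have sub: "{v \<in> V. agree E (P i) u v} \<subseteq> Inr ` L" using same by blast
      show ?thesis
      proof (cases "L = {B}")
        case True
        then have ?one using sub B by blast
        then show ?thesis ..
      next
        case False
        \<comment> \<open>Any second candidate will do as the block that stays unprobed along with
          \<open>B\<close>.\<close>
        then obtain B1 where B1: "B1 \<in> L" "B1 \<noteq> B" using BL by blast
        define Q :: "('a + 'a set) set" where "Q = Inl ` (B - {p}) \<union> Inr ` (L - {B, B1})"
        have L: "L \<subseteq> \<B>" "\<And>D. D \<in> L \<Longrightarrow> p \<in> D" by (auto simp: L_def)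
        have finL: "finite L" using L finite_blocks finite_subset by blast
        have finB: "finite B" using block B finite_points finite_subset by blast
        have "card L \<le> n - card (C i)"
          unfolding L_def
          using card_blocks_through_point_missing[OF gG HAC(1) HAC(2)[symmetric] p(2) HAC(5)] .
        \<comment> \<open>The 2 counts the distinct members \<open>B\<close> and \<open>B1\<close>
          of \<open>L\<close>.\<close>
        then have "card (L - {B, B1}) \<le> n - (k - 3) - 2"
          using True HAC(6)[of i] B1 BL finL by (simp add: card_Diff_subset)
        moreover have cB: "card (B - {p}) = k - 1" using block(2)[OF B(2)] p finB by simp
        moreover have "card Q \<le> card (B - {p}) + card (L - {B, B1})"
          unfolding Q_def using finB finL
          by (intro order.trans[OF card_Un_le] add_mono card_image_le) auto
        \<comment> \<open>The total is \<open>(k - 1) + (n - (k - 3) - 2) = n\<close>: by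
          \<open>k - 3 < n - 1\<close> no subtraction is truncated, and \<open>k \<ge> 4\<close>
          gives \<open>n \<le> m\<close>.\<close>
        ultimately have "card Q \<le> m"
          using conjunct1[OF True] k4 unfolding m_def by linarith
        moreover have "card (B - {p}) \<noteq> 0" using cB k4 by linarith
        then have "B - {p} \<noteq> {}" by (metis card.empty)
        ultimately have "probe V m Q"
          using finB finL block(1)[OF B(2)] L(1)
          by (auto simp: probe_def Q_def incidence_verts_def)
        moreover have "reach E {v \<in> V. agree E (P i) u v} \<subseteq> reach E (Inr ` L)"
          using sub by (auto simp: reach_def)
        ultimately have ?two
          using probe_pencil_locates[OF gG p(2) L BL _ Q_def] k4 by (intro exI[of _ Q]) auto
        then show ?thesis ..
      qed
    qed
  qed
  then show ?thesis by (simp add: m_def)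
qed

end

theorem theorem5p1:
  fixes k n :: nat and X :: "'a set" and \<G> \<B> :: "'a set set"
  assumes "transversal_design k n X \<G> \<B>"
    and "k \<ge> 4"
  shows "localization_number (incidence_verts X \<B>) (incidence_edges X \<B>) \<le> n + k - 4"
proof -
  interpret td k n X \<G> \<B> using assms by unfold_locales auto
  show ?thesis
    unfolding localization_number_def by (rule Least_le) (rule cops_win_incidence[OF assms(2)])
qed

end
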